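(* Let $n,k$ be integers with $1\le k\le n-1$ and let $\sigma\in S_n$. Then $\sigma$ is $k$-prolific in $CK_n$ if and only if $cbr(\sigma)\ge k+3$.
   Context: $S_n$ is the set of permutations of $[n]=\{1,\dots,n\}$, written in one-line notation $\sigma=[\sigma_1,\dots,\sigma_n]$. A cylindrical king permutation of order $n\ge 2$ is $\sigma\in S_n$ with $|\sigma_{i+1}-\sigma_i|>1$ for all $1\le i\le n-1$ and $|\sigma_1-\sigma_n|>1$; $CK_n$ is the set of cylindrical king permutations of order $n$, with the convention $CK_1=S_1$ (one has $CK_2=CK_3=CK_4=\emptyset$). For $1\le i<j\le n$ let $||j-i||=\min(j-i,\;n-j+i)$, and let the cyclic Manhattan distance be $cd_\sigma(i,j)=cd_\sigma(j,i)=|\sigma_j-\sigma_i|+||j-i||$. The cyclic breadth of $\sigma$ (for $n\ge 2$) is $cbr(\sigma)=\min_{i,j\in[n],\,i\ne j} cd_\sigma(i,j)$. The pattern formed by a subset of the entries of $\sigma$ of size $m$ is the permutation in $S_m$ that is order-isomorphic to the subsequence of $[\sigma_1,\dots,\sigma_n]$ consisting of those entries. A permutation $\sigma\in S_n$ is called $k$-prolific in $CK_n$ if $\sigma\in CK_n$ and each $(n-k)$-subset of the entries of $\sigma$ forms a unique pattern in $CK_{n-k}$; that is, the pattern formed by every $(n-k)$-subset of the entries belongs to $CK_{n-k}$, and distinct $(n-k)$-subsets form distinct patterns. *)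

theory Defs
  imports "HOL-Combinatorics.Permutations"
begin

text \<open>
  A permutation in \<open>S\<^sub>n\<close> is a function \<open>\<sigma> :: nat \<Rightarrow> nat\<close> with \<open>\<sigma> permutes {1..n}\<close>; its one-line
  notation is \<open>[\<sigma> 1, \<dots>, \<sigma> n]\<close>. As \<open>permutes\<close> makes the function the identity outside
  \<open>{1..n}\<close>, equality of functions is equality in \<open>S\<^sub>n\<close>. Differences are taken in \<^typ>\<open>int\<close> to avoid
  truncated subtraction.
\<close>

text \<open>Only \<open>n \<ge> 1\<close> is meaningful here.\<close>

definition CK :: "nat \<Rightarrow> (nat \<Rightarrow> nat) set" where
  "CK n =
    (if n = 1 then {\<sigma>. \<sigma> permutes {1..n}}
     else {\<sigma>. \<sigma> permutes {1..n} \<and>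
              (\<forall>i. 1 \<le> i \<and> i \<le> n - 1 \<longrightarrow> \<bar>int (\<sigma> (i + 1)) - int (\<sigma> i)\<bar> > 1) \<and>
              \<bar>int (\<sigma> 1) - int (\<sigma> n)\<bar> > 1})"

text \<open>For \<open>i < j\<close> this is \<open>min (j - i) (n - j + i)\<close>; the absolute value makes it symmetric.\<close>

definition cyclic_dist :: "nat \<Rightarrow> nat \<Rightarrow> nat \<Rightarrow> int" where
  "cyclic_dist n i j = min \<bar>int j - int i\<bar> (int n - \<bar>int j - int i\<bar>)"

definition cd :: "nat \<Rightarrow> (nat \<Rightarrow> nat) \<Rightarrow> nat \<Rightarrow> nat \<Rightarrow> int" where
  "cd n \<sigma> i j = \<bar>int (\<sigma> j) - int (\<sigma> i)\<bar> + cyclic_dist n i j"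

text \<open>Meaningful for \<open>n \<ge> 2\<close>, when the minimum is over a nonempty finite set.\<close>

definition cbr :: "nat \<Rightarrow> (nat \<Rightarrow> nat) \<Rightarrow> int" where
  "cbr n \<sigma> = Min {cd n \<sigma> i j | i j. i \<in> {1..n} \<and> j \<in> {1..n} \<and> i \<noteq> j}"

text \<open>
  A subset of the entries of \<open>\<sigma>\<close> is given by the set \<open>A\<close> of their positions; the corresponding
  subsequence has \<open>r\<close>-th term \<open>subseq_entry \<sigma> A r\<close> for \<open>1 \<le> r \<le> card A\<close>.
\<close>

definition subseq_entry :: "(nat \<Rightarrow> nat) \<Rightarrow> nat set \<Rightarrow> nat \<Rightarrow> nat" where
  "subseq_entry \<sigma> A r = \<sigma> (sorted_list_of_set A ! (r - 1))"

definition is_pattern :: "(nat \<Rightarrow> nat) \<Rightarrow> nat set \<Rightarrow> (nat \<Rightarrow> nat) \<Rightarrow> bool" where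
  "is_pattern \<sigma> A \<tau> \<longleftrightarrow>
     \<tau> permutes {1..card A} \<and>
     (\<forall>r \<in> {1..card A}. \<forall>s \<in> {1..card A}.
        \<tau> r < \<tau> s \<longleftrightarrow> subseq_entry \<sigma> A r < subseq_entry \<sigma> A s)"

definition pattern :: "(nat \<Rightarrow> nat) \<Rightarrow> nat set \<Rightarrow> (nat \<Rightarrow> nat)" where
  "pattern \<sigma> A = (THE \<tau>. is_pattern \<sigma> A \<tau>)"

definition k_prolific :: "nat \<Rightarrow> nat \<Rightarrow> (nat \<Rightarrow> nat) \<Rightarrow> bool" where
  "k_prolific k n \<sigma> \<longleftrightarrow>
     \<sigma> \<in> CK n \<and>
     (\<forall>A. A \<subseteq> {1..n} \<and> card A = n - k \<longrightarrow> pattern \<sigma> A \<in> CK (n - k)) \<and>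
     inj_on (pattern \<sigma>) {A. A \<subseteq> {1..n} \<and> card A = n - k}"

text \<open>The definite description in \<open>pattern\<close> is well defined.\<close>

lemma permutes_eq_rank:
  assumes "\<tau> permutes {1..m}" "r \<in> {1..m}"
  shows "\<tau> r = card {s \<in> {1..m}. \<not> \<tau> r < \<tau> s}"
proof -
  have img: "\<tau> ` {s \<in> {1..m}. \<not> \<tau> r < \<tau> s} = {1..\<tau> r}"
  proof (intro equalityI subsetI)
    fix y assume "y \<in> \<tau> ` {s \<in> {1..m}. \<not> \<tau> r < \<tau> s}"
    then obtain s where s: "s \<in> {1..m}" "\<not> \<tau> r < \<tau> s" "y = \<tau> s" by blast
    have "\<tau> s \<in> {1..m}"
      using permutes_in_image[OF assms(1)] s(1) by blast
    with s(2,3) show "y \<in> {1..\<tau> r}" by simp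
  next
    fix y assume y: "y \<in> {1..\<tau> r}"
    moreover have "\<tau> r \<in> {1..m}"
      using permutes_in_image[OF assms(1)] assms(2) by blast
    ultimately have "y \<in> {1..m}" by simp
    then obtain s where "s \<in> {1..m}" "y = \<tau> s"
      using permutes_image[OF assms(1)] by blast
    with y show "y \<in> \<tau> ` {s \<in> {1..m}. \<not> \<tau> r < \<tau> s}" by auto
  qed
  have "inj_on \<tau> {s \<in> {1..m}. \<not> \<tau> r < \<tau> s}"
    using permutes_inj[OF assms(1)] by (rule inj_on_subset) simp
  then have "card (\<tau> ` {s \<in> {1..m}. \<not> \<tau> r < \<tau> s}) = card {s \<in> {1..m}. \<not> \<tau> r < \<tau> s}"
    by (rule card_image)
  then show ?thesis unfolding img by (simp only: card_atLeastAtMost diff_Suc_1)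
qed

lemma is_pattern_unique:
  assumes "is_pattern \<sigma> A \<tau>" "is_pattern \<sigma> A \<tau>'"
  shows "\<tau> = \<tau>'"
proof
  fix r
  let ?m = "card A"
  have p: "\<tau> permutes {1..?m}" "\<tau>' permutes {1..?m}"
    using assms by (auto simp: is_pattern_def)
  show "\<tau> r = \<tau>' r"
  proof (cases "r \<in> {1..?m}")
    case True
    have "{s \<in> {1..?m}. \<not> \<tau> r < \<tau> s} = {s \<in> {1..?m}. \<not> \<tau>' r < \<tau>' s}"
      using assms True unfolding is_pattern_def by blast
    then show ?thesis
      using permutes_eq_rank[OF p(1) True] permutes_eq_rank[OF p(2) True] by simp
  next
    case False
    then show ?thesis using p by (metis permutes_not_in)
  qed
qed

lemma is_pattern_exists:
  assumes "finite A" "inj_on \<sigma> A"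
  shows "\<exists>\<tau>. is_pattern \<sigma> A \<tau>"
proof -
  let ?m = "card A" and ?e = "subseq_entry \<sigma> A"
  define f where "f r = card {s \<in> {1..?m}. ?e s \<le> ?e r}" for r
  define \<tau> where "\<tau> r = (if r \<in> {1..?m} then f r else r)" for r
  have inj_e: "inj_on ?e {1..?m}"
  proof (rule inj_onI)
    fix r s assume rs: "r \<in> {1..?m}" "s \<in> {1..?m}" "?e r = ?e s"
    have len: "length (sorted_list_of_set A) = ?m" by simp
    have lt: "r - 1 < ?m" "s - 1 < ?m" using rs by auto
    have "sorted_list_of_set A ! (r - 1) \<in> A" "sorted_list_of_set A ! (s - 1) \<in> A"
      using lt len assms(1) by (metis nth_mem set_sorted_list_of_set)+
    with rs(3) assms(2) have "sorted_list_of_set A ! (r - 1) = sorted_list_of_set A ! (s - 1)"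
      by (auto simp: subseq_entry_def dest: inj_onD)
    then have "r - 1 = s - 1"
      using lt len by (simp add: nth_eq_iff_index_eq)
    then show "r = s" using rs by auto
  qed
  have less: "f r < f s" if "r \<in> {1..?m}" "s \<in> {1..?m}" "?e r < ?e s" for r s
  proof -
    have "{t \<in> {1..?m}. ?e t \<le> ?e r} \<subseteq> {t \<in> {1..?m}. ?e t \<le> ?e s}"
      using that(3) by auto
    moreover have "s \<in> {t \<in> {1..?m}. ?e t \<le> ?e s}" "s \<notin> {t \<in> {1..?m}. ?e t \<le> ?e r}"
      using that by auto
    ultimately have "{t \<in> {1..?m}. ?e t \<le> ?e r} \<subset> {t \<in> {1..?m}. ?e t \<le> ?e s}"
      by blast
    then show ?thesis unfolding f_def by (intro psubset_card_mono) auto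
  qed
  have le: "f r \<le> f s" if "?e r \<le> ?e s" for r s
    unfolding f_def using that by (intro card_mono) auto
  have iff: "f r < f s \<longleftrightarrow> ?e r < ?e s" if "r \<in> {1..?m}" "s \<in> {1..?m}" for r s
    using less[OF that] le[of s r] by (meson not_le)
  have inj_f: "inj_on f {1..?m}"
  proof (rule inj_onI)
    fix r s assume rs: "r \<in> {1..?m}" "s \<in> {1..?m}" "f r = f s"
    then have "?e r = ?e s"
      using iff[of r s] iff[of s r] by simp
    then show "r = s" using inj_e rs(1,2) by (blast dest: inj_onD)
  qed
  have in_range: "f r \<in> {1..?m}" if "r \<in> {1..?m}" for r
  proof -
    have "card {r} \<le> f r" unfolding f_def using that by (intro card_mono) auto
    moreover have "f r \<le> card {1..?m}" unfolding f_def by (intro card_mono) auto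
    ultimately show ?thesis by simp
  qed
  have "bij_betw f {1..?m} {1..?m}"
    unfolding bij_betw_def
    using inj_f endo_inj_surj[OF finite_atLeastAtMost image_subsetI[OF in_range] inj_f] by blast
  then have "bij_betw \<tau> {1..?m} {1..?m}"
    by (rule bij_betw_cong[THEN iffD1, rotated]) (simp add: \<tau>_def)
  then have "\<tau> permutes {1..?m}"
    by (rule bij_imp_permutes) (simp only: \<tau>_def if_False)
  then have "is_pattern \<sigma> A \<tau>"
    by (simp add: is_pattern_def \<tau>_def iff)
  then show ?thesis by blast
qed

lemma is_pattern_pattern:
  assumes "finite A" "inj_on \<sigma> A"
  shows "is_pattern \<sigma> A (pattern \<sigma> A)"
proof -
  have "\<exists>!\<tau>. is_pattern \<sigma> A \<tau>"
    using is_pattern_exists[OF assms] is_pattern_unique[of \<sigma> A] by blast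
  then show ?thesis
    unfolding pattern_def by (rule theI')
qed

end

theory Submission
  imports Defs
begin

text \<open>
Read \<open>\<sigma>\<close> as the set of points \<open>(i, \<sigma> i)\<close>. A pattern of at
least two entries fails to be a cylindrical king permutation exactly when two kept entries
\<open>i\<close>, \<open>j\<close> become neighbours in both senses: no kept entry lies on one of
the two position arcs between them, and no kept entry has a value strictly between theirs
(\<open>pattern_in_CK_iff\<close>). To make \<open>i\<close> and \<open>j\<close> neighbours one has
to delete the entries of an arc and those of the gap of values; for the shorter arc this is
\<open>cd n \<sigma> i j - 2\<close> entries, counted with multiplicity. So a pair at distance at
most \<open>k + 2\<close> can be spoiled by \<open>k\<close> deletions
(\<open>close_pair_spoils_pattern\<close>), unless fewer than two entries survive; but all one-entry
subsets form the same pattern. Conversely, if all distances are at least \<open>k + 3\<close>, then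
\<open>k\<close> deletions could suffice only if some entry \<open>p\<close> lay both on the arc and
in the gap; but then the distances from \<open>i\<close> to \<open>p\<close> and from
\<open>p\<close> to \<open>j\<close> add up to at least \<open>2k + 6\<close>, whereas
\<open>k\<close> deletions clear an arc and a gap with combined length at most \<open>2k + 2\<close>
(\<open>far_pairs_keep_gap\<close>).

It remains to see that distinct sets \<open>A\<close>, \<open>B\<close> of \<open>n - k\<close>
entries have distinct patterns when all distances are large. As the cyclic distance of two positions
is at most their distance on the line, all Manhattan distances in the plane are then at least
\<open>k + 2\<close>. Equal patterns give a bijection \<open>\<phi>\<close> from \<open>A\<close> to
\<open>B\<close> preserving both orders. Suppose that it moves some points of \<open>A - B\<close>,
say to the right and up; call these the starts. The quantitative input is a one-dimensional estimate
(\<open>shift_bound\<close>): if \<open>\<phi>\<close> moves \<open>a\<close> to the right by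
\<open>d\<close>, then at least \<open>d\<close> of the \<open>k\<close> points outside
\<open>B\<close> are right-moving points of \<open>A - B\<close> to the left of \<open>\<phi>
a\<close>, or lie outside \<open>A\<close> and between \<open>a\<close> and \<open>\<phi> a\<close>.
The same holds vertically. Since there are only \<open>k\<close> points outside \<open>B\<close>
while a displacement \<open>(d, v)\<close> has \<open>d + v \<ge> k + 2\<close>, the horizontal and
the vertical count must overlap, and the overlap consists of starts (\<open>corner_count\<close>).
For \<open>a\<close> a minimal start this gives a second minimal start below and to the left of
\<open>\<phi> a\<close>. Walking along the antichain of minimal starts one finds two consecutive
ones, \<open>a\<close> and below and to the right of it \<open>a'\<close>, each lying below and to
the left of the image of the other. Combining the horizontal count for \<open>a\<close> with the
vertical count for \<open>a'\<close> now forces so many starts into one corner that \<open>a\<close>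
and \<open>a'\<close> have distance at most \<open>k\<close>, a contradiction
(\<open>northeast_starts_empty\<close>). The other three directions follow by reflection.
\<close>

section \<open>Displacement on a line\<close>

lemma card_strictly_between:
  fixes x :: "'a \<Rightarrow> int"
  assumes "inj_on x E" and "x ` E = {l..u}" and "l - 1 \<le> s" and "t \<le> u + 1" and "s < t"
  shows "int (card {w \<in> E. s < x w \<and> x w < t}) = t - s - 1"
proof -
  have "x ` {w \<in> E. s < x w \<and> x w < t} = {s<..<t}"
  proof
    show "x ` {w \<in> E. s < x w \<and> x w < t} \<subseteq> {s<..<t}" by auto
    show "{s<..<t} \<subseteq> x ` {w \<in> E. s < x w \<and> x w < t}"
    proof
      fix z assume z: "z \<in> {s<..<t}"
      then have "z \<in> x ` E" using assms by auto
      with z show "z \<in> x ` {w \<in> E. s < x w \<and> x w < t}" by auto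
    qed
  qed
  moreover have "inj_on x {w \<in> E. s < x w \<and> x w < t}"
    using assms(1) by (rule inj_on_subset) auto
  ultimately have "card {w \<in> E. s < x w \<and> x w < t} = card {s<..<t}"
    by (metis card_image)
  then show ?thesis using assms(5) by simp
qed

text \<open>
The points from \<open>a\<close> up to, but excluding, \<open>\<phi> a\<close> are of three kinds. Those outside \<open>A\<close> and \<open>B\<close>
are counted by the last term. Those in \<open>A - B\<close> are moved beyond \<open>\<phi> a\<close> or onto it by monotonicity,
so they move to the right. Those in \<open>B\<close> are as numerous as the excess of \<open>A\<close> over \<open>B\<close> to the left
of \<open>a\<close>, because \<open>\<phi>\<close> matches the points of \<open>A\<close> left of \<open>a\<close> with the points of \<open>B\<close> left of \<open>\<phi> a\<close>; and
an excess of \<open>A\<close> over \<open>B\<close> up to some place can only be produced by right-moving points of \<open>A - B\<close>.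
\<close>

lemma shift_bound:
  fixes x :: "'a \<Rightarrow> int"
  assumes fin: "finite E" and inj: "inj_on x E" and img: "x ` E = {l..u}"
    and AE: "A \<subseteq> E" and BE: "B \<subseteq> E" and bij: "bij_betw \<phi> A B"
    and mono: "\<And>p q. p \<in> A \<Longrightarrow> q \<in> A \<Longrightarrow> x (\<phi> p) < x (\<phi> q) \<longleftrightarrow> x p < x q"
    and a: "a \<in> A" and right: "x a < x (\<phi> a)"
  shows "x (\<phi> a) - x a \<le>
    int (card {w \<in> A - B. x w < x (\<phi> w) \<and> x w < x (\<phi> a)}) +
    int (card {w \<in> E - A - B. x a < x w \<and> x w < x (\<phi> a)})"
proof -
  define R where "R = {w \<in> A - B. x w < x (\<phi> w)}"
  let ?b = "\<phi> a"
  have finA: "finite A" and finB: "finite B" using AE BE fin finite_subset by auto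
  have finR: "finite R" using finA by (simp add: R_def)
  have \<phi>B: "\<phi> p \<in> B" if "p \<in> A" for p using bij that by (auto simp: bij_betw_def)
  have inj\<phi>: "inj_on \<phi> A" using bij by (simp add: bij_betw_def)
  have mono_le: "x (\<phi> p) \<le> x (\<phi> q)" if "p \<in> A" "q \<in> A" "x p \<le> x q" for p q
    using mono[of q p] that by auto
  have excess: "card {p \<in> A. x p < t} \<le> card {p \<in> B. x p < t} + card {w \<in> R. x w < t}" for t
  proof (cases "{p \<in> A. x p < t \<and> x (\<phi> p) \<le> x p} = {}")
    case True
    then have "{p \<in> A. x p < t} \<subseteq> {p \<in> B. x p < t} \<union> {w \<in> R. x w < t}"
      by (auto simp: R_def not_le)
    then have "card {p \<in> A. x p < t} \<le> card ({p \<in> B. x p < t} \<union> {w \<in> R. x w < t})"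
      using finB finR by (intro card_mono) auto
    then show ?thesis by (rule order_trans[OF _ card_Un_le])
  next
    case False
    \<comment> \<open>Up to the last point \<open>c\<close> before \<open>t\<close> that does not move right, \<open>\<phi>\<close>
      maps \<open>A\<close> into \<open>B\<close>, so there is no excess; all points of \<open>A\<close>
      between \<open>c\<close> and \<open>t\<close> move right.\<close>
    let ?D = "{p \<in> A. x p < t \<and> x (\<phi> p) \<le> x p}"
    obtain c where c: "c \<in> ?D" and cmax: "\<And>p. p \<in> ?D \<Longrightarrow> x p \<le> x c"
    proof -
      have finD: "finite (x ` ?D)" using finA by simp
      then have "Max (x ` ?D) \<in> x ` ?D" using False by (intro Max_in) blast+
      then obtain c where c: "Max (x ` ?D) = x c" "c \<in> ?D" by (rule imageE)
      have "x p \<le> x c" if "p \<in> ?D" for p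
        using Max_ge[OF finD imageI[of p _ x, OF that]] c(1) by simp
      with c(2) show thesis by (rule that)
    qed
    have "\<phi> ` {p \<in> A. x p \<le> x c} \<subseteq> {p \<in> B. x p \<le> x c}"
    proof
      fix q assume "q \<in> \<phi> ` {p \<in> A. x p \<le> x c}"
      then obtain p where p: "q = \<phi> p" "p \<in> A" "x p \<le> x c" by blast
      with c mono_le[of p c] \<phi>B[of p] show "q \<in> {p \<in> B. x p \<le> x c}" by simp
    qed
    then have "card (\<phi> ` {p \<in> A. x p \<le> x c}) \<le> card {p \<in> B. x p \<le> x c}"
      using finB by (intro card_mono) auto
    moreover have "card (\<phi> ` {p \<in> A. x p \<le> x c}) = card {p \<in> A. x p \<le> x c}"
      by (intro card_image inj_on_subset[OF inj\<phi>]) auto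
    ultimately have low: "card {p \<in> A. x p \<le> x c} \<le> card {p \<in> B. x p \<le> x c}"
      by simp
    have "{p \<in> A. x p < t} \<subseteq>
        {p \<in> A. x p \<le> x c} \<union> {p \<in> B. x c < x p \<and> x p < t} \<union> {w \<in> R. x w < t}"
    proof
      fix p assume p: "p \<in> {p \<in> A. x p < t}"
      show "p \<in> {p \<in> A. x p \<le> x c} \<union> {p \<in> B. x c < x p \<and> x p < t} \<union> {w \<in> R. x w < t}"
        using p cmax[of p] by (simp add: R_def) linarith
    qed
    then have "card {p \<in> A. x p < t} \<le>
        card ({p \<in> A. x p \<le> x c} \<union> {p \<in> B. x c < x p \<and> x p < t} \<union> {w \<in> R. x w < t})"
      using finA finB finR by (intro card_mono) auto
    also have "\<dots> \<le> card {p \<in> A. x p \<le> x c} + card {p \<in> B. x c < x p \<and> x p < t} + card {w \<in> R. x w < t}"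
      by (rule order_trans[OF card_Un_le add_right_mono[OF card_Un_le]])
    also have "\<dots> \<le> card {p \<in> B. x p \<le> x c} + card {p \<in> B. x c < x p \<and> x p < t} + card {w \<in> R. x w < t}"
      using low by simp
    also have "card {p \<in> B. x p \<le> x c} + card {p \<in> B. x c < x p \<and> x p < t}
        = card ({p \<in> B. x p \<le> x c} \<union> {p \<in> B. x c < x p \<and> x p < t})"
      using finB by (intro card_Un_disjoint[symmetric]) auto
    also have "{p \<in> B. x p \<le> x c} \<union> {p \<in> B. x c < x p \<and> x p < t} = {p \<in> B. x p < t}"
      using c by auto
    finally show ?thesis .
  qed
  have "\<phi> ` {p \<in> A. x p < x a} = {p \<in> B. x p < x ?b}"
  proof
    show "\<phi> ` {p \<in> A. x p < x a} \<subseteq> {p \<in> B. x p < x ?b}" using mono a \<phi>B by auto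
    show "{p \<in> B. x p < x ?b} \<subseteq> \<phi> ` {p \<in> A. x p < x a}"
    proof
      fix q assume q: "q \<in> {p \<in> B. x p < x ?b}"
      then obtain p where "p \<in> A" "q = \<phi> p" using bij by (auto simp: bij_betw_def)
      with q mono[of p a] a show "q \<in> \<phi> ` {p \<in> A. x p < x a}" by auto
    qed
  qed
  moreover have "inj_on \<phi> {p \<in> A. x p < x a}" by (rule inj_on_subset[OF inj\<phi>]) auto
  ultimately have same: "card {p \<in> A. x p < x a} = card {p \<in> B. x p < x ?b}"
    by (metis card_image)
  have "{p \<in> B. x p < x ?b} = {p \<in> B. x p < x a} \<union> {p \<in> B. x a \<le> x p \<and> x p < x ?b}"
    using right by auto
  moreover have "card ({p \<in> B. x p < x a} \<union> {p \<in> B. x a \<le> x p \<and> x p < x ?b})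
      = card {p \<in> B. x p < x a} + card {p \<in> B. x a \<le> x p \<and> x p < x ?b}"
    using finB by (intro card_Un_disjoint) auto
  ultimately have "card {p \<in> B. x p < x ?b} =
      card {p \<in> B. x p < x a} + card {p \<in> B. x a \<le> x p \<and> x p < x ?b}"
    by simp
  then have inB: "card {p \<in> B. x a \<le> x p \<and> x p < x ?b} \<le> card {w \<in> R. x w < x a}"
    using same excess[of "x a"] by linarith
  have "a \<in> E" "?b \<in> E" using a AE BE \<phi>B by auto
  then have "x a \<in> {l..u}" "x ?b \<in> {l..u}" using img by blast+
  then have "int (card {w \<in> E. x a - 1 < x w \<and> x w < x ?b}) = x ?b - x a"
    using card_strictly_between[OF inj img, of "x a - 1" "x ?b"] right by simp
  moreover have "{w \<in> E. x a - 1 < x w \<and> x w < x ?b} \<subseteq>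
      {p \<in> B. x a \<le> x p \<and> x p < x ?b} \<union> {w \<in> R. x a \<le> x w \<and> x w < x ?b} \<union>
      {w \<in> E - A - B. x a < x w \<and> x w < x ?b}"
  proof
    fix w assume w: "w \<in> {w \<in> E. x a - 1 < x w \<and> x w < x ?b}"
    have "x w \<noteq> x a" if "w \<notin> A" using inj_onD[OF inj, of w a] w a AE that by auto
    moreover have "x w < x (\<phi> w)" if "w \<in> A" using mono_le[of a w] a w that by auto
    ultimately show "w \<in> {p \<in> B. x a \<le> x p \<and> x p < x ?b} \<union> {w \<in> R. x a \<le> x w \<and> x w < x ?b} \<union>
      {w \<in> E - A - B. x a < x w \<and> x w < x ?b}"
      using w by (force simp: R_def)
  qed
  then have "card {w \<in> E. x a - 1 < x w \<and> x w < x ?b} \<le> card (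
      {p \<in> B. x a \<le> x p \<and> x p < x ?b} \<union> {w \<in> R. x a \<le> x w \<and> x w < x ?b} \<union>
      {w \<in> E - A - B. x a < x w \<and> x w < x ?b})"
    using finB finR fin by (intro card_mono) auto
  moreover have "\<dots> \<le> card {p \<in> B. x a \<le> x p \<and> x p < x ?b} + card {w \<in> R. x a \<le> x w \<and> x w < x ?b}
      + card {w \<in> E - A - B. x a < x w \<and> x w < x ?b}"
    by (rule order_trans[OF card_Un_le add_right_mono[OF card_Un_le]])
  moreover have "card {w \<in> R. x w < x a} + card {w \<in> R. x a \<le> x w \<and> x w < x ?b}
      = card {w \<in> R. x w < x ?b}"
  proof -
    have "{w \<in> R. x w < x ?b} = {w \<in> R. x w < x a} \<union> {w \<in> R. x a \<le> x w \<and> x w < x ?b}"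
      using right by auto
    moreover have "card ({w \<in> R. x w < x a} \<union> {w \<in> R. x a \<le> x w \<and> x w < x ?b})
      = card {w \<in> R. x w < x a} + card {w \<in> R. x a \<le> x w \<and> x w < x ?b}"
      using finR by (intro card_Un_disjoint) auto
    ultimately show ?thesis by simp
  qed
  moreover have "{w \<in> A - B. x w < x (\<phi> w) \<and> x w < x (\<phi> a)} = {w \<in> R. x w < x ?b}"
    by (auto simp: R_def)
  ultimately show ?thesis using inB by simp
qed

section \<open>Two occurrences of one pattern in a spread-out point set\<close>

text \<open>
\<open>A\<close> and \<open>B\<close> are two occurrences of the same pattern among the points of \<open>E\<close>, and \<open>\<phi>\<close> sends each
point of the first to the corresponding point of the second. Coordinates are integers ranging over
arbitrary intervals, so that the setting is preserved by reflection.
\<close>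

locale spread_matching =
  fixes E A B :: "'a set" and x y :: "'a \<Rightarrow> int" and \<phi> :: "'a \<Rightarrow> 'a" and k :: nat
  assumes fin: "finite E" and AE: "A \<subseteq> E" and BE: "B \<subseteq> E" and card_EB: "card (E - B) = k"
    and inj_x: "inj_on x E" and inj_y: "inj_on y E"
    and img_x: "\<exists>l u. x ` E = {l..u}" and img_y: "\<exists>l u. y ` E = {l..u}"
    and bij: "bij_betw \<phi> A B"
    and mono_x: "\<And>p q. p \<in> A \<Longrightarrow> q \<in> A \<Longrightarrow> x (\<phi> p) < x (\<phi> q) \<longleftrightarrow> x p < x q"
    and mono_y: "\<And>p q. p \<in> A \<Longrightarrow> q \<in> A \<Longrightarrow> y (\<phi> p) < y (\<phi> q) \<longleftrightarrow> y p < y q"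
    and spread: "\<And>p q. p \<in> E \<Longrightarrow> q \<in> E \<Longrightarrow> p \<noteq> q \<Longrightarrow> int k + 2 \<le> \<bar>x p - x q\<bar> + \<bar>y p - y q\<bar>"
begin

lemma swap: "spread_matching E A B y x \<phi> k"
  using fin AE BE card_EB inj_x inj_y img_x img_y bij mono_x mono_y spread
  by unfold_locales (auto simp: add.commute)

lemma reflect: "spread_matching E A B (\<lambda>w. - x w) y \<phi> k"
proof unfold_locales
  show "\<exists>l u. (\<lambda>w. - x w) ` E = {l..u}"
  proof -
    obtain l u where "x ` E = {l..u}" using img_x by blast
    then have "uminus ` x ` E = {- u..- l}" by simp
    then show ?thesis by (auto simp: image_image)
  qed
  show "inj_on (\<lambda>w. - x w) E" using inj_x by (simp add: inj_on_def)
  show "int k + 2 \<le> \<bar>- x p - - x q\<bar> + \<bar>y p - y q\<bar>" if "p \<in> E" "q \<in> E" "p \<noteq> q" for p q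
    using spread[OF that] by linarith
qed (use fin AE BE card_EB inj_y img_y bij mono_x mono_y in auto)

text \<open>
Following \<open>\<phi>\<close> decomposes \<open>A \<union> B\<close> into chains and fixed points; the points of \<open>A - B\<close> are the beginnings
of the chains.
\<close>

definition "right_starts = {w \<in> A - B. x w < x (\<phi> w)}"
definition "up_starts = {w \<in> A - B. y w < y (\<phi> w)}"
definition "never_used = E - A - B"

abbreviation "northeast_starts \<equiv> right_starts \<inter> up_starts"

lemma \<phi>_in: "p \<in> A \<Longrightarrow> \<phi> p \<in> B"
  using bij by (auto simp: bij_betw_def)

lemma finite_starts: "finite right_starts" "finite up_starts" "finite never_used"
  using fin finite_subset[OF AE fin] by (auto simp: right_starts_def up_starts_def never_used_def)

text \<open>
All these points lie outside \<open>B\<close>; the budget \<open>k\<close> is what every later count is compared with.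
\<close>

lemma card_starts_le: "card (right_starts \<union> up_starts) + card never_used \<le> k"
proof -
  have "card (right_starts \<union> up_starts) + card never_used =
      card ((right_starts \<union> up_starts) \<union> never_used)"
    using finite_starts by (intro card_Un_disjoint[symmetric])
      (auto simp: right_starts_def up_starts_def never_used_def)
  also have "\<dots> \<le> card (E - B)"
    using fin AE by (intro card_mono) (auto simp: right_starts_def up_starts_def never_used_def)
  finally show ?thesis using card_EB by simp
qed

lemma right_bound:
  assumes "a \<in> A" and "x a < x (\<phi> a)"
  shows "x (\<phi> a) - x a \<le> int (card {w \<in> right_starts. x w < x (\<phi> a)}) +
    int (card {w \<in> never_used. x a < x w \<and> x w < x (\<phi> a)})"
proof -
  obtain l u where "x ` E = {l..u}" using img_x by blast
  moreover have "{w \<in> A - B. x w < x (\<phi> w) \<and> x w < x (\<phi> a)} = {w \<in> right_starts. x w < x (\<phi> a)}"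
    by (auto simp: right_starts_def)
  ultimately show ?thesis
    using shift_bound[OF fin inj_x _ AE BE bij mono_x assms, of l u] by (simp add: never_used_def)
qed

lemma right_le:
  assumes "a \<in> A" and "x a < x (\<phi> a)"
  shows "x (\<phi> a) - x a \<le> int k"
proof -
  have "card {w \<in> right_starts. x w < x (\<phi> a)} \<le> card (right_starts \<union> up_starts)"
    "card {w \<in> never_used. x a < x w \<and> x w < x (\<phi> a)} \<le> card never_used"
    using finite_starts by (auto intro: card_mono)
  then show ?thesis using right_bound[OF assms] card_starts_le by linarith
qed

interpretation sw: spread_matching E A B y x \<phi> k
  by (rule swap)

lemma up_bound:
  assumes "a \<in> A" and "y a < y (\<phi> a)"
  shows "y (\<phi> a) - y a \<le> int (card {w \<in> up_starts. y w < y (\<phi> a)}) +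
    int (card {w \<in> never_used. y a < y w \<and> y w < y (\<phi> a)})"
  using sw.right_bound[OF assms]
  by (simp add: sw.right_starts_def up_starts_def sw.never_used_def never_used_def)

text \<open>
A point \<open>p\<close> strictly inside the rectangle spanned by \<open>a\<close> and \<open>\<phi> a\<close> would split this displacement
into two, each of length at least \<open>k + 2\<close>. But each coordinate of the displacement is at most \<open>k\<close>.
\<close>

lemma crossing_strips_empty:
  assumes "a \<in> A" and "x a < x (\<phi> a)" and "y a < y (\<phi> a)" and "p \<in> E"
    and "x a < x p" and "x p < x (\<phi> a)" and "y a < y p" and "y p < y (\<phi> a)"
  shows False
proof -
  have E: "a \<in> E" "\<phi> a \<in> E" using assms(1) \<phi>_in AE BE by auto
  have "int k + 2 \<le> \<bar>x a - x p\<bar> + \<bar>y a - y p\<bar>"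
    using assms E by (intro spread) auto
  moreover have "int k + 2 \<le> \<bar>x p - x (\<phi> a)\<bar> + \<bar>y p - y (\<phi> a)\<bar>"
    using assms E by (intro spread) auto
  ultimately show False
    using right_le[OF assms(1,2)] sw.right_le[OF assms(1,3)] assms(5-8) by linarith
qed

text \<open>
The horizontal bound for \<open>a\<close> and the vertical bound for \<open>c\<close> both count points outside \<open>B\<close>, of which
there are \<open>k\<close>. What they count twice are the starts in the corner to the left of \<open>\<phi> a\<close> and below
\<open>\<phi> c\<close>: the unused points are counted once, because the vertical strip of \<open>a\<close> and the horizontal
strip of \<open>c\<close> do not meet. The lemma is applied both with \<open>c = a\<close> and with two different starts.
\<close>

lemma corner_count:
  assumes "a \<in> A" "x a < x (\<phi> a)" and "c \<in> A" "y c < y (\<phi> c)"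
    and empty: "\<And>p. p \<in> E \<Longrightarrow> x a < x p \<Longrightarrow> x p < x (\<phi> a) \<Longrightarrow>
      y c < y p \<Longrightarrow> y p < y (\<phi> c) \<Longrightarrow> False"
  shows "x (\<phi> a) - x a + (y (\<phi> c) - y c) \<le>
    int k + int (card {w \<in> northeast_starts. x w < x (\<phi> a) \<and> y w < y (\<phi> c)})"
proof -
  let ?R = "{w \<in> right_starts. x w < x (\<phi> a)}" and ?U = "{w \<in> up_starts. y w < y (\<phi> c)}"
  let ?P = "{w \<in> never_used. x a < x w \<and> x w < x (\<phi> a)}"
    and ?V = "{w \<in> never_used. y c < y w \<and> y w < y (\<phi> c)}"
  have "card ?R + card ?U = card (?R \<union> ?U) + card (?R \<inter> ?U)"
    using finite_starts by (intro card_Un_Int) auto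
  moreover have "card (?R \<union> ?U) \<le> card (right_starts \<union> up_starts)"
    using finite_starts by (intro card_mono) auto
  moreover have "?R \<inter> ?U = {w \<in> northeast_starts. x w < x (\<phi> a) \<and> y w < y (\<phi> c)}" by auto
  moreover have "card ?P + card ?V = card (?P \<union> ?V)"
  proof (rule card_Un_disjoint[symmetric])
    show "?P \<inter> ?V = {}" using empty by (auto simp: never_used_def)
  qed (use finite_starts(3) in auto)
  moreover have "card (?P \<union> ?V) \<le> card never_used"
    using finite_starts by (intro card_mono) auto
  ultimately show ?thesis
    using right_bound[OF assms(1,2)] up_bound[OF assms(3,4)] card_starts_le by simp
qed

text \<open>
The minimal starts form an antichain descending from left to right. Each has another one to the
lower left of its image, so the leftmost reaches over its right neighbour and the rightmost over
its left neighbour; hence somewhere two consecutive ones \<open>a\<close>, \<open>a'\<close> reach over each other. Every other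
start in the corner left of \<open>\<phi> a\<close> and below \<open>\<phi> a'\<close> then lies right of \<open>a'\<close> or above \<open>a\<close>, so the
corner contains few starts if \<open>a\<close> and \<open>a'\<close> are far apart, and more than that by \<open>corner_count\<close>.
\<close>

lemma northeast_starts_empty: "northeast_starts = {}"
proof (rule ccontr)
  assume nonempty: "northeast_starts \<noteq> {}"
  define M where "M = {m \<in> northeast_starts. \<not> (\<exists>w \<in> northeast_starts. x w < x m \<and> y w < y m)}"
  have S: "w \<in> A" "w \<in> E" "x w < x (\<phi> w)" "y w < y (\<phi> w)" if "w \<in> northeast_starts" for w
    using that AE by (auto simp: right_starts_def up_starts_def)
  have finM: "finite M" using finite_starts by (simp add: M_def)
  have MS: "m \<in> northeast_starts" if "m \<in> M" for m using that by (simp add: M_def)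
  have below: "\<exists>m \<in> M. m = w \<or> x m < x w \<and> y m < y w" if "w \<in> northeast_starts" for w
    using that
  proof (induction "card {v \<in> northeast_starts. x v < x w}"
      arbitrary: w rule: less_induct)
    case less
    show ?case
    proof (cases "w \<in> M")
      case True
      then show ?thesis by blast
    next
      case False
      then obtain v where v: "v \<in> northeast_starts" "x v < x w" "y v < y w"
        using less.prems by (auto simp: M_def)
      then have "{u \<in> northeast_starts. x u < x v} \<subset> {u \<in> northeast_starts. x u < x w}" by auto
      then have "card {u \<in> northeast_starts. x u < x v} < card {u \<in> northeast_starts. x u < x w}"
        using finite_starts by (intro psubset_card_mono) auto
      then obtain m where m: "m \<in> M" "m = v \<or> x m < x v \<and> y m < y v"
        using less.hyps v(1) by blast
      then have "x m < x w \<and> y m < y w" using v by auto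
      with m(1) show ?thesis by blast
    qed
  qed
  have antichain: "y n < y m" if "m \<in> M" "n \<in> M" "x m < x n" for m n
  proof -
    have "\<not> y m < y n" using that by (auto simp: M_def)
    moreover have "y m \<noteq> y n"
      using inj_onD[OF inj_y, of m n] S(2)[OF MS] that by auto
    ultimately show ?thesis by simp
  qed
  have neighbour: "\<exists>c \<in> M. c \<noteq> a \<and> x c < x (\<phi> a) \<and> y c < y (\<phi> a)" if a: "a \<in> M" for a
  proof -
    let ?N = "{w \<in> northeast_starts. x w < x (\<phi> a) \<and> y w < y (\<phi> a)}"
    note Sa = S[OF MS[OF a]]
    have "\<phi> a \<in> E" using \<phi>_in Sa(1) BE by auto
    then have "int k + 2 \<le> \<bar>x a - x (\<phi> a)\<bar> + \<bar>y a - y (\<phi> a)\<bar>"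
      using Sa by (intro spread) auto
    moreover have "x (\<phi> a) - x a + (y (\<phi> a) - y a) \<le> int k + int (card ?N)"
      using Sa crossing_strips_empty[OF Sa(1,3,4)] by (intro corner_count) auto
    \<comment> \<open>The displacement is at least \<open>k + 2\<close>, so the corner holds at least two
      starts, one of them other than \<open>a\<close>.\<close>
    ultimately have "\<not> card ?N \<le> 1" using Sa by linarith
    moreover have "card ?N \<le> 1" if "?N \<subseteq> {a}"
      using card_mono[OF _ that] by simp
    ultimately obtain w where w: "w \<in> ?N" "w \<noteq> a" by blast
    then obtain m where m: "m \<in> M" "m = w \<or> x m < x w \<and> y m < y w" using below by blast
    \<comment> \<open>If \<open>m\<close> were \<open>a\<close>, then \<open>w\<close> would lie inside the rectangle spanned by \<open>a\<close> and \<open>\<phi> a\<close>.\<close>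
    have "m \<noteq> a"
    proof
      assume "m = a"
      with w m have "x a < x w" "y a < y w" by auto
      with w Sa S(2) show False
        using crossing_strips_empty[OF Sa(1,3,4), of w] by auto
    qed
    with m w show ?thesis by auto
  qed
  \<comment> \<open>\<open>Q\<close> collects the minimal starts that reach over some minimal start to their
    right. It contains the leftmost minimal start. Its rightmost element \<open>a\<close> and
    the next minimal start \<open>a'\<close>, which is not in \<open>Q\<close> and hence
    reaches over one to its left, are the pair sought.\<close>
  define Q where "Q = {a \<in> M. \<exists>c \<in> M. x a < x c \<and> x c < x (\<phi> a)}"
  have finQ: "finite Q" using finM by (simp add: Q_def)
  have inj_M: "inj_on x M" using inj_x S(2) MS by (meson inj_on_subset subsetI)
  have "M \<noteq> {}" using nonempty below by blast
  then have "Min (x ` M) \<in> x ` M" using finM by (intro Min_in) auto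
  then obtain f where f: "Min (x ` M) = x f" "f \<in> M" by (rule imageE)
  have first: "x f \<le> x m" if "m \<in> M" for m
    using Min_le[of "x ` M" "x m"] finM that f(1) by simp
  obtain c where c: "c \<in> M" "c \<noteq> f" "x c < x (\<phi> f)" using neighbour[OF f(2)] by blast
  have "x f \<noteq> x c" using inj_onD[OF inj_M] c f by auto
  then have "f \<in> Q" using first[OF c(1)] c f by (force simp: Q_def)
  then have "Max (x ` Q) \<in> x ` Q" using finQ by (intro Max_in) auto
  then obtain a where aQ: "Max (x ` Q) = x a" "a \<in> Q" by (rule imageE)
  have last: "x m \<le> x a" if "m \<in> Q" for m
    using Max_ge[of "x ` Q" "x m"] finQ that aQ(1) by simp
  let ?L = "{m \<in> M. x a < x m}"
  obtain c where c: "c \<in> M" "x a < x c" "x c < x (\<phi> a)" and aM: "a \<in> M"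
    using aQ(2) by (auto simp: Q_def)
  then have "Min (x ` ?L) \<in> x ` ?L" using finM by (intro Min_in) auto
  then obtain a' where a': "Min (x ` ?L) = x a'" "a' \<in> ?L" by (rule imageE)
  have nearest: "x a' \<le> x m" if "m \<in> M" "x a < x m" for m
    using Min_le[of "x ` ?L" "x m"] finM that a'(1) by auto
  have a'M: "a' \<in> M" and aa': "x a < x a'" using a'(2) by auto
  have a'b: "x a' < x (\<phi> a)" using nearest[OF c(1,2)] c(3) by simp
  have "a' \<notin> Q" using last[of a'] aa' by auto
  obtain e where e: "e \<in> M" "e \<noteq> a'" "x e < x (\<phi> a')" "y e < y (\<phi> a')"
    using neighbour[OF a'M] by blast
  have "x e \<noteq> x a'" using inj_onD[OF inj_M] e a'M by auto
  then have "x e < x a'" using \<open>a' \<notin> Q\<close> e a'M by (force simp: Q_def)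
  then have "x e \<le> x a" using nearest[OF e(1)] by force
  then have "y a \<le> y e"
    using antichain[OF e(1) aM] inj_onD[OF inj_M, of e a] e(1) aM by force
  then have ab': "y a < y (\<phi> a')" using e(4) by simp
  have ya: "y a' < y a" using antichain[OF aM a'M aa'] .
  note Sa = S[OF MS[OF aM]] and Sa' = S[OF MS[OF a'M]]
  have b: "x (\<phi> a) < x (\<phi> a')" using mono_x[OF Sa(1) Sa'(1)] aa' by simp
  have b': "y (\<phi> a') < y (\<phi> a)" using mono_y[OF Sa'(1) Sa(1)] ya by simp
  have short: "x (\<phi> a) - x a \<le> int k" "y (\<phi> a') - y a' \<le> int k"
    using right_le[OF Sa(1,3)] sw.right_le[OF Sa'(1,4)] .
  \<comment> \<open>The vertical strip of \<open>a\<close> and the horizontal strip of \<open>a'\<close> do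
    not meet: a common point would lie inside the rectangle spanned by \<open>a\<close> and
    \<open>a'\<close> and split their distance, which is at most \<open>2k\<close>, into two
    parts of at least \<open>k + 2\<close>.\<close>
  have empty: False
    if p: "p \<in> E" "x a < x p" "x p < x (\<phi> a)" "y a' < y p" "y p < y (\<phi> a')" for p
  proof -
    \<comment> \<open>Both inequalities hold because the rectangles of \<open>a\<close> and of
      \<open>a'\<close> are empty.\<close>
    have "y p \<le> y a"
      using crossing_strips_empty[OF Sa(1,3,4) p(1-3)] p b' by force
    moreover have "x p \<le> x a'"
      using crossing_strips_empty[OF Sa'(1,3,4) p(1) _ _ p(4,5)] p b by force
    moreover have "int k + 2 \<le> \<bar>x a - x p\<bar> + \<bar>y a - y p\<bar>"
      using Sa p by (intro spread) auto
    moreover have "int k + 2 \<le> \<bar>x p - x a'\<bar> + \<bar>y p - y a'\<bar>"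
      using Sa' p by (intro spread) auto
    ultimately show False using short p a'b ab' by linarith
  qed
  let ?N = "{w \<in> northeast_starts. x w < x (\<phi> a) \<and> y w < y (\<phi> a')}"
  let ?X = "{w \<in> E. x a' < x w \<and> x w < x (\<phi> a)}" and ?Y = "{w \<in> E. y a < y w \<and> y w < y (\<phi> a')}"
  have "x (\<phi> a) - x a + (y (\<phi> a') - y a') \<le> int k + int (card ?N)"
    using Sa Sa' empty by (intro corner_count) auto
  \<comment> \<open>A start left of \<open>a'\<close> and below \<open>a\<close> would have a minimal start at
    or below it, which by the choice of \<open>a'\<close> is not right of \<open>a\<close>,
    yet is lower than \<open>a\<close>: impossible in an antichain.\<close>
  moreover have "?N \<subseteq> {a, a'} \<union> (?X \<union> ?Y)"
  proof
    fix w assume w: "w \<in> ?N"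
    then have wE: "w \<in> E" using S(2) by auto
    show "w \<in> {a, a'} \<union> (?X \<union> ?Y)"
    proof (rule ccontr)
      assume out: "w \<notin> {a, a'} \<union> (?X \<union> ?Y)"
      have "x w \<noteq> x a'" "y w \<noteq> y a"
        using out inj_onD[OF inj_x, of w a'] inj_onD[OF inj_y, of w a] wE Sa(2) Sa'(2) by auto
      with out w wE have less: "x w < x a'" "y w < y a" by auto
      obtain m where m: "m \<in> M" "m = w \<or> x m < x w \<and> y m < y w" using below[of w] w by blast
      then have m': "x m < x a'" "y m < y a" using less by auto
      then have "x m \<le> x a" using nearest[OF m(1)] by force
      then show False
        using antichain[OF m(1) aM] inj_onD[OF inj_M, of m a] m(1) aM m' by force
    qed
  qed
  then have "card ?N \<le> card ({a, a'} \<union> (?X \<union> ?Y))" using fin by (intro card_mono) auto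
  moreover have "card ({a, a'} \<union> (?X \<union> ?Y)) \<le> card {a, a'} + (card ?X + card ?Y)"
    by (rule order_trans[OF card_Un_le add_left_mono[OF card_Un_le]])
  moreover have "card {a, a'} \<le> 2" by (simp add: card_insert_if)
  moreover have "int (card ?X) = x (\<phi> a) - x a' - 1"
  proof -
    obtain l u where lu: "x ` E = {l..u}" using img_x by blast
    moreover have "x a' \<in> {l..u}" "x (\<phi> a) \<in> {l..u}"
      using Sa Sa' \<phi>_in BE lu by blast+
    ultimately show ?thesis using card_strictly_between[OF inj_x lu] a'b by simp
  qed
  moreover have "int (card ?Y) = y (\<phi> a') - y a - 1"
  proof -
    obtain l u where lu: "y ` E = {l..u}" using img_y by blast
    moreover have "y a \<in> {l..u}" "y (\<phi> a') \<in> {l..u}"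
      using Sa Sa' \<phi>_in BE lu by blast+
    ultimately show ?thesis using card_strictly_between[OF inj_y lu] ab' by simp
  qed
  moreover have "int k + 2 \<le> \<bar>x a - x a'\<bar> + \<bar>y a - y a'\<bar>"
    using Sa Sa' aa' by (intro spread) auto
  ultimately show False using aa' ya by linarith
qed

text \<open>
Each point of \<open>A - B\<close> moves in both coordinates, hence in one of four diagonal directions; the
reflected settings turn each of them into a move to the right and up.
\<close>

lemma A_subset_B: "A \<subseteq> B"
proof
  fix w assume w: "w \<in> A"
  interpret x': spread_matching E A B "\<lambda>w. - x w" y \<phi> k
    by (rule reflect)
  interpret sw: spread_matching E A B y x \<phi> k
    by (rule swap)
  interpret y': spread_matching E A B "\<lambda>w. - y w" x \<phi> k
    by (rule sw.reflect)
  interpret x'': spread_matching E A B x "\<lambda>w. - y w" \<phi> k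
    by (rule y'.swap)
  interpret xy': spread_matching E A B "\<lambda>w. - x w" "\<lambda>w. - y w" \<phi> k
    by (rule x''.reflect)
  show "w \<in> B"
  proof (rule ccontr)
    assume "w \<notin> B"
    with w have "\<phi> w \<noteq> w" "w \<in> E" "\<phi> w \<in> E"
      using \<phi>_in[OF w] AE BE by auto
    then have "x (\<phi> w) \<noteq> x w" "y (\<phi> w) \<noteq> y w"
      using inj_x inj_y by (auto dest: inj_onD)
    moreover have "w \<in> A - B" using w \<open>w \<notin> B\<close> by simp
    ultimately show False
      using northeast_starts_empty x'.northeast_starts_empty
        x''.northeast_starts_empty xy'.northeast_starts_empty
      unfolding right_starts_def up_starts_def x'.right_starts_def x'.up_starts_def
        x''.right_starts_def x''.up_starts_def
        xy'.right_starts_def xy'.up_starts_def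
      by (auto simp: disjoint_iff linorder_neq_iff)
  qed
qed

end


section \<open>Cyclic distance\<close>

lemma cbr_ge_iff:
  assumes "2 \<le> n"
  shows "K \<le> cbr n \<sigma> \<longleftrightarrow> (\<forall>i \<in> {1..n}. \<forall>j \<in> {1..n}. i < j \<longrightarrow> K \<le> cd n \<sigma> i j)"
proof -
  let ?D = "{cd n \<sigma> i j | i j. i \<in> {1..n} \<and> j \<in> {1..n} \<and> i \<noteq> j}"
  have "?D \<subseteq> (\<lambda>(i, j). cd n \<sigma> i j) ` ({1..n} \<times> {1..n})" by auto
  then have "finite ?D" by (rule finite_subset) simp
  moreover have "cd n \<sigma> 1 2 \<in> ?D" using assms by force
  ultimately have "K \<le> cbr n \<sigma> \<longleftrightarrow> (\<forall>d \<in> ?D. K \<le> d)"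
    unfolding cbr_def by (intro Min_ge_iff) auto
  also have "\<dots> \<longleftrightarrow> (\<forall>i \<in> {1..n}. \<forall>j \<in> {1..n}. i \<noteq> j \<longrightarrow> K \<le> cd n \<sigma> i j)" by blast
  also have "\<dots> \<longleftrightarrow> (\<forall>i \<in> {1..n}. \<forall>j \<in> {1..n}. i < j \<longrightarrow> K \<le> cd n \<sigma> i j)"
  proof -
    have "cd n \<sigma> i j = cd n \<sigma> j i" for i j
      by (simp add: cd_def cyclic_dist_def abs_minus_commute)
    then show ?thesis by (metis less_irrefl linorder_neqE_nat)
  qed
  finally show ?thesis .
qed

text \<open>
The two arcs between \<open>i\<close> and \<open>j\<close> on the cycle of positions are \<open>{i<..<j}\<close> and \<open>{1..n} - {i..j}\<close>.
\<close>

lemma cyclic_dist_eq_arcs: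
  assumes "i \<in> {1..n}" and "j \<in> {1..n}" and "i < j"
  shows "cyclic_dist n i j = 1 + int (min (card {i<..<j}) (card ({1..n} - {i..j})))"
proof -
  have "card ({1..n} - {i..j}) = n - (j + 1 - i)"
    using assms by (subst card_Diff_subset) auto
  moreover have "card {i<..<j} = j - i - 1" by simp
  ultimately show ?thesis using assms by (auto simp: cyclic_dist_def)
qed

section \<open>Patterns and the cylindrical king condition\<close>

definition nth_position :: "nat set \<Rightarrow> nat \<Rightarrow> nat" where
  "nth_position A r = sorted_list_of_set A ! (r - 1)"

lemma nth_position_less_iff:
  assumes "r \<in> {1..card A}" and "s \<in> {1..card A}"
  shows "nth_position A r < nth_position A s \<longleftrightarrow> r < s"
proof -
  have "nth_position A r' < nth_position A s'"
    if "r' < s'" "r' \<in> {1..card A}" "s' \<in> {1..card A}" for r' s'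
    unfolding nth_position_def using that
    by (intro sorted_wrt_nth_less[OF strict_sorted_list_of_set]) auto
  from this[of r s] this[of s r] show ?thesis
    using assms by (metis less_asym nat_neq_iff)
qed

lemma bij_nth_position:
  assumes "finite A"
  shows "bij_betw (nth_position A) {1..card A} A"
proof -
  have inj: "inj_on (nth_position A) {1..card A}"
  proof (rule inj_onI)
    fix r s assume "r \<in> {1..card A}" "s \<in> {1..card A}" "nth_position A r = nth_position A s"
    then show "r = s"
      using nth_position_less_iff[of r A s] nth_position_less_iff[of s A r] by simp
  qed
  moreover have "nth_position A ` {1..card A} \<subseteq> A"
  proof
    fix p assume "p \<in> nth_position A ` {1..card A}"
    then obtain r where r: "r \<in> {1..card A}" "p = sorted_list_of_set A ! (r - 1)"
      by (auto simp: nth_position_def)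
    then have "p \<in> set (sorted_list_of_set A)" by (auto intro: nth_mem)
    then show "p \<in> A" using assms by simp
  qed
  ultimately show ?thesis
    using card_subset_eq[OF assms] card_image[OF inj] by (simp add: bij_betw_def)
qed

definition value_gap :: "(nat \<Rightarrow> nat) \<Rightarrow> nat \<Rightarrow> nat \<Rightarrow> nat set" where
  "value_gap \<sigma> i j = {p. min (\<sigma> i) (\<sigma> j) < \<sigma> p \<and> \<sigma> p < max (\<sigma> i) (\<sigma> j)}"

context
  fixes n :: nat and \<sigma> :: "nat \<Rightarrow> nat"
  assumes perm: "\<sigma> permutes {1..n}"
begin

lemma inj_values: "inj_on (\<lambda>p. int (\<sigma> p)) E"
  using permutes_inj[OF perm] by (auto simp: inj_on_def)

lemma image_values: "(\<lambda>p. int (\<sigma> p)) ` {1..n} = {1..int n}"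
proof -
  have "int ` \<sigma> ` {1..n} = int ` {1..n}" using permutes_image[OF perm] by simp
  then show ?thesis by (simp add: image_image image_int_atLeastAtMost)
qed

lemma card_value_gap:
  assumes "i \<in> {1..n}" and "j \<in> {1..n}" and "i \<noteq> j"
  shows "int (card ({1..n} \<inter> value_gap \<sigma> i j)) = \<bar>int (\<sigma> j) - int (\<sigma> i)\<bar> - 1"
proof -
  let ?s = "int (min (\<sigma> i) (\<sigma> j))" and ?t = "int (max (\<sigma> i) (\<sigma> j))"
  have "\<sigma> i \<noteq> \<sigma> j" using permutes_inj[OF perm] assms(3) by (auto dest: injD)
  moreover have "\<sigma> i \<in> {1..n}" "\<sigma> j \<in> {1..n}" using assms permutes_in_image[OF perm] by blast+
  ultimately have "int (card {p \<in> {1..n}. ?s < int (\<sigma> p) \<and> int (\<sigma> p) < ?t}) = ?t - ?s - 1"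
    by (intro card_strictly_between[OF inj_values image_values]) auto
  moreover have "{p \<in> {1..n}. ?s < int (\<sigma> p) \<and> int (\<sigma> p) < ?t} = {1..n} \<inter> value_gap \<sigma> i j"
    by (auto simp: value_gap_def)
  ultimately show ?thesis by (simp add: min_def max_def split: if_splits)
qed

lemma pattern_props:
  assumes "A \<subseteq> {1..n}"
  shows "pattern \<sigma> A permutes {1..card A}"
    and "r \<in> {1..card A} \<Longrightarrow> s \<in> {1..card A} \<Longrightarrow>
      pattern \<sigma> A r < pattern \<sigma> A s \<longleftrightarrow> \<sigma> (nth_position A r) < \<sigma> (nth_position A s)"
proof -
  have "finite A" "inj_on \<sigma> A"
    using assms permutes_inj[OF perm] by (auto intro: finite_subset inj_on_subset)
  then have "is_pattern \<sigma> A (pattern \<sigma> A)" by (rule is_pattern_pattern)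
  then show "pattern \<sigma> A permutes {1..card A}"
    and "r \<in> {1..card A} \<Longrightarrow> s \<in> {1..card A} \<Longrightarrow>
      pattern \<sigma> A r < pattern \<sigma> A s \<longleftrightarrow> \<sigma> (nth_position A r) < \<sigma> (nth_position A s)"
    by (auto simp: is_pattern_def subseq_entry_def nth_position_def)
qed

text \<open>
The values of the pattern fill \<open>{1..card A}\<close>, so two of them differ by one exactly when no third
one lies between, and order isomorphism carries this over to the values of \<open>\<sigma>\<close> on \<open>A\<close>.
\<close>

lemma pattern_gap_iff:
  assumes A: "A \<subseteq> {1..n}" and rs: "r \<in> {1..card A}" "s \<in> {1..card A}" "r \<noteq> s"
  shows "\<bar>int (pattern \<sigma> A r) - int (pattern \<sigma> A s)\<bar> > 1 \<longleftrightarrow>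
    A \<inter> value_gap \<sigma> (nth_position A r) (nth_position A s) \<noteq> {}"
proof -
  let ?\<tau> = "pattern \<sigma> A" and ?e = "nth_position A"
  note p = pattern_props[OF A]
  have finA: "finite A" using A finite_subset by auto
  have eA: "A = ?e ` {1..card A}" using bij_nth_position[OF finA] by (simp add: bij_betw_def)
  have ordered: "\<bar>int (?\<tau> r) - int (?\<tau> s)\<bar> > 1 \<longleftrightarrow> A \<inter> value_gap \<sigma> (?e r) (?e s) \<noteq> {}"
    if rs: "r \<in> {1..card A}" "s \<in> {1..card A}" "?\<tau> r < ?\<tau> s" for r s
  proof -
    have lt: "\<sigma> (?e r) < \<sigma> (?e s)" using p(2)[OF rs(1,2)] rs(3) by simp
    have "A \<inter> value_gap \<sigma> (?e r) (?e s) \<noteq> {} \<longleftrightarrow>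
        (\<exists>t \<in> {1..card A}. \<sigma> (?e r) < \<sigma> (?e t) \<and> \<sigma> (?e t) < \<sigma> (?e s))"
      using lt by (subst eA) (auto simp: value_gap_def)
    also have "\<dots> \<longleftrightarrow> (\<exists>t \<in> {1..card A}. ?\<tau> r < ?\<tau> t \<and> ?\<tau> t < ?\<tau> s)"
      using p(2) rs by simp
    also have "\<dots> \<longleftrightarrow> (\<exists>v \<in> ?\<tau> ` {1..card A}. ?\<tau> r < v \<and> v < ?\<tau> s)" by blast
    also have "?\<tau> ` {1..card A} = {1..card A}" by (rule permutes_image[OF p(1)])
    also have "(\<exists>v \<in> {1..card A}. ?\<tau> r < v \<and> v < ?\<tau> s) \<longleftrightarrow> ?\<tau> r + 1 < ?\<tau> s"
    proof
      assume "?\<tau> r + 1 < ?\<tau> s"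
      moreover have "?\<tau> s \<in> {1..card A}" using permutes_in_image[OF p(1)] rs(2) by blast
      ultimately show "\<exists>v \<in> {1..card A}. ?\<tau> r < v \<and> v < ?\<tau> s"
        by (intro bexI[of _ "?\<tau> r + 1"]) auto
    qed auto
    finally show ?thesis using rs(3) by auto
  qed
  have "?\<tau> r \<noteq> ?\<tau> s" using permutes_inj[OF p(1)] rs(3) by (auto dest: injD)
  then consider "?\<tau> r < ?\<tau> s" | "?\<tau> s < ?\<tau> r" by linarith
  then show ?thesis
  proof cases
    case 1
    then show ?thesis using ordered rs by blast
  next
    case 2
    then show ?thesis using ordered[OF rs(2,1)]
      by (simp add: value_gap_def abs_minus_commute min.commute max.commute)
  qed
qed

text \<open>
Two kept entries are cyclically adjacent in the pattern if they are consecutive in \<open>A\<close>, or if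
they are its first and last element; these are the two alternatives \<open>A \<inter> {i<..<j} = {}\<close> and
\<open>A \<subseteq> {i..j}\<close>.
\<close>

lemma pattern_in_CK_iff:
  assumes A: "A \<subseteq> {1..n}" and two: "2 \<le> card A"
  shows "pattern \<sigma> A \<in> CK (card A) \<longleftrightarrow>
    (\<forall>i \<in> A. \<forall>j \<in> A. i < j \<and> (A \<inter> {i<..<j} = {} \<or> A \<subseteq> {i..j}) \<longrightarrow>
      A \<inter> value_gap \<sigma> i j \<noteq> {})" (is "?L \<longleftrightarrow> ?R")
proof -
  let ?m = "card A" and ?e = "nth_position A" and ?\<tau> = "pattern \<sigma> A"
  have finA: "finite A" using A finite_subset by auto
  have bij: "bij_betw ?e {1..?m} A" by (rule bij_nth_position[OF finA])
  then have eA: "?e r \<in> A" if "r \<in> {1..?m}" for r using that by (auto simp: bij_betw_def)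
  have index: "\<exists>r \<in> {1..?m}. i = ?e r" if "i \<in> A" for i
    using that bij by (auto simp: bij_betw_def)
  note less = nth_position_less_iff[of _ A]
  have "?L \<longleftrightarrow> (\<forall>r. 1 \<le> r \<and> r \<le> ?m - 1 \<longrightarrow> \<bar>int (?\<tau> (r + 1)) - int (?\<tau> r)\<bar> > 1) \<and>
      \<bar>int (?\<tau> 1) - int (?\<tau> ?m)\<bar> > 1"
    using two pattern_props(1)[OF A] by (simp add: CK_def)
  also have "\<dots> \<longleftrightarrow> (\<forall>r. 1 \<le> r \<and> r \<le> ?m - 1 \<longrightarrow> A \<inter> value_gap \<sigma> (?e r) (?e (r + 1)) \<noteq> {}) \<and>
      A \<inter> value_gap \<sigma> (?e 1) (?e ?m) \<noteq> {}" (is "_ \<longleftrightarrow> ?adj \<and> ?wrap")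
  proof -
    have "\<bar>int (?\<tau> (r + 1)) - int (?\<tau> r)\<bar> > 1 \<longleftrightarrow> A \<inter> value_gap \<sigma> (?e r) (?e (r + 1)) \<noteq> {}"
      if "1 \<le> r \<and> r \<le> ?m - 1" for r
    proof -
      have "r \<in> {1..?m}" "r + 1 \<in> {1..?m}" "r \<noteq> r + 1" using that two by auto
      from pattern_gap_iff[OF A this] show ?thesis by (simp only: abs_minus_commute)
    qed
    moreover have "\<bar>int (?\<tau> 1) - int (?\<tau> ?m)\<bar> > 1 \<longleftrightarrow> ?wrap"
      using two by (intro pattern_gap_iff[OF A]) auto
    ultimately show ?thesis by blast
  qed
  also have "\<dots> \<longleftrightarrow> ?R"
  proof
    assume adj_wrap: "?adj \<and> ?wrap"
    show ?R
    proof (intro ballI impI)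
      fix i j assume ij: "i \<in> A" "j \<in> A" "i < j \<and> (A \<inter> {i<..<j} = {} \<or> A \<subseteq> {i..j})"
      then obtain r s where rs: "r \<in> {1..?m}" "s \<in> {1..?m}" "i = ?e r" "j = ?e s"
        using index by meson
      then have "r < s" using less[of r s] ij(3) by simp
      show "A \<inter> value_gap \<sigma> i j \<noteq> {}"
      proof (cases "A \<inter> {i<..<j} = {}")
        case True
        have "s = r + 1"
        proof (rule ccontr)
          assume "s \<noteq> r + 1"
          then have "r + 1 < s" "r + 1 \<in> {1..?m}" using \<open>r < s\<close> rs(2) by auto
          then have "?e (r + 1) \<in> A \<inter> {i<..<j}" using eA less rs by simp
          then show False using True by blast
        qed
        moreover have "1 \<le> r \<and> r \<le> ?m - 1" using rs(1,2) \<open>r < s\<close> by auto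
        ultimately show ?thesis using adj_wrap rs(3,4) by blast
      next
        case False
        then have sub: "A \<subseteq> {i..j}" using ij(3) by blast
        have ends: "1 \<in> {1..?m}" "?m \<in> {1..?m}" using two by auto
        have "?e r \<le> ?e 1" "?e ?m \<le> ?e s"
          using subsetD[OF sub eA[OF ends(1)]] subsetD[OF sub eA[OF ends(2)]] rs(3,4) by auto
        then have "\<not> 1 < r" "\<not> s < ?m" using less[OF ends(1) rs(1)] less[OF rs(2) ends(2)] by auto
        then have "r = 1" "s = ?m" using rs(1,2) by auto
        then show ?thesis using adj_wrap rs(3,4) by blast
      qed
    qed
  next
    assume R: ?R
    have ?adj
    proof (intro allI impI)
      fix r assume "1 \<le> r \<and> r \<le> ?m - 1"
      then have r: "r \<in> {1..?m}" "r + 1 \<in> {1..?m}" using two by auto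
      have "A \<inter> {?e r<..<?e (r + 1)} = {}"
      proof (rule ccontr)
        assume "A \<inter> {?e r<..<?e (r + 1)} \<noteq> {}"
        then obtain t where "t \<in> {1..?m}" "?e r < ?e t" "?e t < ?e (r + 1)"
          using index by force
        then show False using less[OF r(1)] less[OF _ r(2)] by auto
      qed
      then show "A \<inter> value_gap \<sigma> (?e r) (?e (r + 1)) \<noteq> {}"
        using R eA r less[OF r] by simp
    qed
    moreover have ?wrap
    proof -
      have ends: "1 \<in> {1..?m}" "?m \<in> {1..?m}" using two by auto
      have "A \<subseteq> {?e 1..?e ?m}"
      proof
        fix p assume "p \<in> A"
        then obtain t where t: "t \<in> {1..?m}" "p = ?e t" using index by blast
        then have "\<not> ?e t < ?e 1" "\<not> ?e ?m < ?e t"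
          using less[OF t(1) ends(1)] less[OF ends(2) t(1)] by auto
        then show "p \<in> {?e 1..?e ?m}" using t(2) by simp
      qed
      then show ?thesis using R eA ends less[OF ends] two by simp
    qed
    ultimately show "?adj \<and> ?wrap" by blast
  qed
  finally show ?thesis .
qed

section \<open>Large distances determine a subset by its pattern\<close>

lemma equal_patterns_imp_equal:
  assumes spread: "\<And>i j. i \<in> {1..n} \<Longrightarrow> j \<in> {1..n} \<Longrightarrow> i \<noteq> j \<Longrightarrow>
      int k + 2 \<le> \<bar>int i - int j\<bar> + \<bar>int (\<sigma> i) - int (\<sigma> j)\<bar>"
    and A: "A \<subseteq> {1..n}" "card A = n - k" and B: "B \<subseteq> {1..n}" "card B = n - k"
    and k: "k \<le> n" and eq: "pattern \<sigma> A = pattern \<sigma> B"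
  shows "A = B"
proof -
  let ?m = "n - k"
  let ?a = "nth_position A" and ?b = "nth_position B"
  have finA: "finite A" and finB: "finite B" using A B finite_subset by auto
  have bijA: "bij_betw ?a {1..?m} A" and bijB: "bij_betw ?b {1..?m} B"
    using bij_nth_position[OF finA] bij_nth_position[OF finB] A(2) B(2) by auto
  define \<phi> where "\<phi> = ?b \<circ> the_inv_into {1..?m} ?a"
  have \<phi>a: "\<phi> (?a r) = ?b r" if "r \<in> {1..?m}" for r
    using the_inv_into_f_f[OF bij_betw_imp_inj_on[OF bijA] that] by (simp add: \<phi>_def)
  have index: "\<exists>r \<in> {1..?m}. p = ?a r" if "p \<in> A" for p
    using that bijA by (auto simp: bij_betw_def)
  interpret spread_matching "{1..n}" A B int "\<lambda>p. int (\<sigma> p)" \<phi> k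
  proof
    show "card ({1..n} - B) = k" using B k finB by (simp add: card_Diff_subset)
    show "\<exists>l u. int ` {1..n} = {l..u}" by (auto simp: image_int_atLeastAtMost)
    show "\<exists>l u. (\<lambda>p. int (\<sigma> p)) ` {1..n} = {l..u}" using image_values by blast
    show "bij_betw \<phi> A B"
      unfolding \<phi>_def by (rule bij_betw_trans[OF bij_betw_the_inv_into[OF bijA] bijB])
    fix p q assume "p \<in> A" "q \<in> A"
    then obtain r s where rs: "r \<in> {1..?m}" "s \<in> {1..?m}" "p = ?a r" "q = ?a s"
      using index by meson
    show "int (\<phi> p) < int (\<phi> q) \<longleftrightarrow> int p < int q"
      using nth_position_less_iff[of r A s] nth_position_less_iff[of r B s] A B rs \<phi>a by simp
    show "int (\<sigma> (\<phi> p)) < int (\<sigma> (\<phi> q)) \<longleftrightarrow> int (\<sigma> p) < int (\<sigma> q)"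
      using pattern_props(2)[OF A(1), of r s] pattern_props(2)[OF B(1), of r s] A B rs \<phi>a eq by simp
  qed (use A B spread inj_values in auto)
  show ?thesis using A_subset_B card_subset_eq[OF finB] A(2) B(2) by simp
qed

section \<open>Deleting entries around a pair\<close>

text \<open>
Deleting the shorter arc between \<open>i\<close> and \<open>j\<close> and the entries with values between theirs costs at
most \<open>cd n \<sigma> i j - 2 \<le> k\<close> deletions and makes \<open>i\<close> and \<open>j\<close> neighbours in position and in value. The
remaining deletions can be spent on other entries than \<open>i\<close> and \<open>j\<close>, because at least two entries
survive.
\<close>

lemma close_pair_spoils_pattern:
  assumes ij: "i \<in> {1..n}" "j \<in> {1..n}" "i < j"
    and close: "cd n \<sigma> i j < int k + 3" and k: "k + 2 \<le> n"
  shows "\<exists>A. A \<subseteq> {1..n} \<and> card A = n - k \<and> pattern \<sigma> A \<notin> CK (n - k)"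
proof -
  obtain I where I: "I = {i<..<j} \<or> I = {1..n} - {i..j}" "cyclic_dist n i j = 1 + int (card I)"
    using cyclic_dist_eq_arcs[OF ij] by (metis min_def)
  let ?V = "{1..n} \<inter> value_gap \<sigma> i j"
  have "int (card I) + int (card ?V) \<le> int k"
    using close I(2) card_value_gap[OF ij(1,2)] ij(3) by (simp add: cd_def)
  then have "card (I \<union> ?V) \<le> k" using card_Un_le[of I ?V] by linarith
  moreover have "I \<union> ?V \<subseteq> {1..n} - {i, j}"
    using I(1) ij by (auto simp: value_gap_def)
  moreover have "k \<le> card ({1..n} - {i, j})"
    using ij k by (subst card_Diff_subset) auto
  ultimately obtain D where D: "I \<union> ?V \<subseteq> D" "D \<subseteq> {1..n} - {i, j}" "card D = k"
    using exists_subset_between[of "I \<union> ?V" k "{1..n} - {i, j}"] by auto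
  define A where "A = {1..n} - D"
  have "D \<subseteq> {1..n}" using D(2) by blast
  then have A: "A \<subseteq> {1..n}" "card A = n - k"
    using D(3) by (auto simp: A_def card_Diff_subset finite_subset)
  have "i \<in> A" "j \<in> A" "A \<inter> value_gap \<sigma> i j = {}" using D ij by (auto simp: A_def)
  moreover have "A \<inter> I = {}" using D(1) by (auto simp: A_def)
  then have "A \<inter> {i<..<j} = {} \<or> A \<subseteq> {i..j}" using I(1) A(1) by auto
  ultimately have "pattern \<sigma> A \<notin> CK (card A)"
    using pattern_in_CK_iff[OF A(1)] A(2) k ij(3) by auto
  with A show ?thesis by auto
qed

text \<open>
Otherwise an arc \<open>I\<close> and the entries \<open>?V\<close> with values in the gap are both among the \<open>k\<close> deleted
entries. If they are disjoint, then \<open>cd n \<sigma> i j \<le> card I + card ?V + 2 \<le> k + 2\<close>. A common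
element \<open>p\<close> would split the way from \<open>i\<close> to \<open>j\<close> along the arc into two of length at least \<open>k + 3\<close>,
although arc and gap have length at most \<open>k + 1\<close> each.
\<close>

lemma far_pairs_keep_gap:
  assumes far: "\<And>i j. i \<in> {1..n} \<Longrightarrow> j \<in> {1..n} \<Longrightarrow> i \<noteq> j \<Longrightarrow> int k + 3 \<le> cd n \<sigma> i j"
    and A: "A \<subseteq> {1..n}" "card A = n - k" "k \<le> n"
    and ij: "i \<in> A" "j \<in> A" "i < j"
    and arc: "A \<inter> {i<..<j} = {} \<or> A \<subseteq> {i..j}"
  shows "A \<inter> value_gap \<sigma> i j \<noteq> {}"
proof
  assume gap: "A \<inter> value_gap \<sigma> i j = {}"
  have ijn: "i \<in> {1..n}" "j \<in> {1..n}" using ij A by auto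
  obtain I where I: "I = {i<..<j} \<or> I = {1..n} - {i..j}" "A \<inter> I = {}"
    using arc by blast
  let ?V = "{1..n} \<inter> value_gap \<sigma> i j"
  have IV: "I \<subseteq> {1..n} - A" "?V \<subseteq> {1..n} - A" using I gap ijn by auto
  have deleted: "card ({1..n} - A) = k"
    using A finite_subset[OF A(1)] by (simp add: card_Diff_subset)
  have cards: "card I \<le> k" "card ?V \<le> k"
    using card_mono[OF _ IV(1)] card_mono[OF _ IV(2)] deleted by auto
  have V: "int (card ?V) = \<bar>int (\<sigma> j) - int (\<sigma> i)\<bar> - 1"
    using card_value_gap[OF ijn] ij(3) by simp
  have arc_length: "card I = j - i - 1 \<and> I = {i<..<j} \<or>
      card I = n - (j + 1 - i) \<and> I = {1..n} - {i..j}"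
    using I(1)
  proof
    assume "I = {1..n} - {i..j}"
    moreover have "card ({1..n} - {i..j}) = n - (j + 1 - i)"
      using ijn ij(3) by (subst card_Diff_subset) auto
    ultimately show ?thesis by simp
  qed auto
  have disj: "I \<inter> ?V = {}"
  proof (rule ccontr)
    assume "I \<inter> ?V \<noteq> {}"
    then obtain p where p: "p \<in> I" "p \<in> {1..n}" "p \<in> value_gap \<sigma> i j" by blast
    have "p \<noteq> i" "p \<noteq> j" using p(3) by (auto simp: value_gap_def)
    then have "int k + 3 \<le> cd n \<sigma> i p" "int k + 3 \<le> cd n \<sigma> p j"
      using far ijn p(2) by auto
    moreover have "\<bar>int (\<sigma> p) - int (\<sigma> i)\<bar> + \<bar>int (\<sigma> j) - int (\<sigma> p)\<bar> = \<bar>int (\<sigma> j) - int (\<sigma> i)\<bar>"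
      using p(3) by (auto simp: value_gap_def min_def max_def split: if_splits)
    moreover have "cyclic_dist n i p + cyclic_dist n p j \<le> 1 + int (card I)"
      using arc_length p(1,2) ijn ij(3) by (auto simp: cyclic_dist_def)
    ultimately show False using cards V by (simp add: cd_def)
  qed
  have "card I + card ?V = card (I \<union> ?V)"
    using disj IV by (intro card_Un_disjoint[symmetric]) (auto intro: finite_subset)
  also have "\<dots> \<le> k"
    using IV deleted card_mono[of "{1..n} - A" "I \<union> ?V"] by auto
  finally have "int (card I) + int (card ?V) \<le> int k" by simp
  moreover have "cyclic_dist n i j \<le> 1 + int (card I)"
    using arc_length ijn ij(3) by (auto simp: cyclic_dist_def)
  moreover have "int k + 3 \<le> cd n \<sigma> i j" using far ijn ij(3) by simp
  ultimately show False using V by (simp add: cd_def)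
qed

end

theorem theorem2p11:
  fixes n k :: nat and \<sigma> :: "nat \<Rightarrow> nat"
  assumes "1 \<le> k" and "k \<le> n - 1" and "\<sigma> permutes {1..n}"
  shows "k_prolific k n \<sigma> \<longleftrightarrow> cbr n \<sigma> \<ge> int k + 3"
proof
  note perm = assms(3)
  have n: "2 \<le> n" "k \<le> n" using assms(1,2) by auto
  assume prolific: "k_prolific k n \<sigma>"
  \<comment> \<open>Single entries all have the same pattern, so \<open>k = n - 1\<close> violates uniqueness.\<close>
  have "k \<noteq> n - 1"
  proof
    assume k: "k = n - 1"
    have "pattern \<sigma> {1} permutes {1..1}" "pattern \<sigma> {2} permutes {1..1}"
      using pattern_props(1)[OF perm, of "{1}"] pattern_props(1)[OF perm, of "{2}"] n by auto
    then have "pattern \<sigma> {1} = pattern \<sigma> {2}" by (simp add: permutes_sing)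
    moreover have "inj_on (pattern \<sigma>) {A. A \<subseteq> {1..n} \<and> card A = n - k}"
      using prolific by (simp add: k_prolific_def)
    ultimately have "{1::nat} = {2}" using n k by (elim inj_onD) auto
    then show False by simp
  qed
  then have "k + 2 \<le> n" using assms(2) by simp
  then show "int k + 3 \<le> cbr n \<sigma>"
    using prolific close_pair_spoils_pattern[OF perm, of _ _ k]
    unfolding cbr_ge_iff[OF n(1)] k_prolific_def by (meson not_le)
next
  note perm = assms(3)
  have n: "2 \<le> n" "k \<le> n" using assms(1,2) by auto
  assume "int k + 3 \<le> cbr n \<sigma>"
  then have far_less: "int k + 3 \<le> cd n \<sigma> i j" if "i \<in> {1..n}" "j \<in> {1..n}" "i < j" for i j
    using that by (simp add: cbr_ge_iff[OF n(1)])
  have far: "int k + 3 \<le> cd n \<sigma> i j" if "i \<in> {1..n}" "j \<in> {1..n}" "i \<noteq> j" for i j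
    using far_less[of i j] far_less[of j i] that
    by (cases "i < j") (auto simp: cd_def cyclic_dist_def abs_minus_commute)
  show "k_prolific k n \<sigma>"
    unfolding k_prolific_def
  proof (intro conjI allI impI)
    have "\<bar>int (\<sigma> (i + 1)) - int (\<sigma> i)\<bar> > 1" if "1 \<le> i \<and> i \<le> n - 1" for i
    proof -
      have "i + 1 \<le> n" using that n by auto
      then show ?thesis using far[of i "i + 1"] that assms(1) by (auto simp: cd_def cyclic_dist_def)
    qed
    moreover have "\<bar>int (\<sigma> 1) - int (\<sigma> n)\<bar> > 1"
      using far[of n 1] n assms(1) by (auto simp: cd_def cyclic_dist_def)
    ultimately show "\<sigma> \<in> CK n" using perm n by (simp add: CK_def)
  next
    fix A assume A: "A \<subseteq> {1..n} \<and> card A = n - k"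
    show "pattern \<sigma> A \<in> CK (n - k)"
    proof (cases "n - k = 1")
      case True
      then show ?thesis using pattern_props(1)[OF perm, of A] A by (simp add: CK_def)
    next
      case False
      then have "2 \<le> card A" using A assms by auto
      then have "pattern \<sigma> A \<in> CK (card A)"
        using A far_pairs_keep_gap[OF perm far _ _ n(2)] by (subst pattern_in_CK_iff[OF perm]) auto
      then show ?thesis using A by simp
    qed
  next
    have "int k + 2 \<le> \<bar>int i - int j\<bar> + \<bar>int (\<sigma> i) - int (\<sigma> j)\<bar>"
      if "i \<in> {1..n}" "j \<in> {1..n}" "i \<noteq> j" for i j
      using far[OF that] by (auto simp: cd_def cyclic_dist_def)
    then show "inj_on (pattern \<sigma>) {A. A \<subseteq> {1..n} \<and> card A = n - k}"
      using equal_patterns_imp_equal[OF perm] n(2) by (intro inj_onI) blast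
  qed
qed

end
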